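(* Let $T=M_wEM_u$ be a bounded WCT operator on the Orlicz space $L^\Phi(\Sigma)$ such that $|E(wu)|<1$ on $S(\Phi^{-1}(E(\Phi(w))))\cap S(\Psi^{-1}(E(\Psi(u))))$ and $\mathcal{R}(I-T)$ is closed. Then $L^\Phi(\mu)=\mathcal{R}(I-T)\oplus\mathcal{N}(I-T)$.
   Context: $(X,\Sigma,\mu)$ is a complete $\sigma$-finite measure space; functions are complex-valued, identified when equal $\mu$-a.e., and relations between functions on sets hold $\mu$-a.e. A Young function is a convex even function $\Phi:\mathbb{R}\to[0,\infty]$ with $\Phi(0)=0$, neither identically $0$ nor identically $\infty$ on $(0,\infty)$, and left-continuous at $b_\Phi=\sup\{x>0:\Phi(x)<\infty\}$. $\Phi$ is a Young function with complementary function $\Psi(y)=\sup\{x|y|-\Phi(x):x\ge 0\}$. For a measurable function $f$, $\Phi(f)$ means $\Phi(|f|)$. The generalized inverse is $\Phi^{-1}(y)=\inf\{x\ge0:\Phi(x)>y\}$ (with $\inf\emptyset=+\infty$, so $\Phi^{-1}(+\infty)=+\infty$), and similarly for $\Psi^{-1}$. The Orlicz space is $L^\Phi(\mu)=L^\Phi(\Sigma)=\{f \text{ measurable}: \exists k>0,\ \int_X\Phi(kf)\,d\mu<\infty\}$, a Banach space with norm $N_\Phi(f)=\inf\{k>0:\int_X\Phi(f/k)\,d\mu\le1\}$. $\mathcal{A}\subseteq\Sigma$ is a sub-$\sigma$-algebra such that $\mu|_{\mathcal A}$ is $\sigma$-finite, and $E=E^{\mathcal A}$ is the conditional expectation: $E(f)$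 is the unique $\mathcal A$-measurable function with $\int_A f\,d\mu=\int_A E(f)\,d\mu$ for $A\in\mathcal A$, defined for $f\ge0$ and extended by linearity to measurable $f$ with $E(|f|)<\infty$ a.e. For measurable $u,w:X\to\mathbb{C}$, the WCT (weighted conditional type) operator $T=M_wEM_u$ is $T(f)=wE(uf)$, where it is understood that $E(uw)$ and $E(uf)$, $f\in L^\Phi(\mu)$, are defined. $S(f)=\{x\in X: f(x)\ne0\}$. $\mathcal{N}(S)$ and $\mathcal{R}(S)$ denote the null space and range of an operator $S$; $I$ is the identity. *)

theory Defs
  imports "HOL-Probability.Probability"
begin

text \<open>Functions that are equal almost everywhere are identified throughout. Since HOL has no
  dependent quotient, spaces of classes are represented by the sets of all representatives: the
  sets below are closed under almost everywhere equality among measurable functions, and ``equal''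
  and ``zero'' are read almost everywhere.\<close>

subsection \<open>Young functions\<close>

text \<open>In \<^term>\<open>young_function\<close>, convexity is spelled out because \<^term>\<open>convex_on\<close> only covers
  vector-valued functions; at the endpoints it uses \<open>0 * \<infinity> = 0\<close> in \<^typ>\<open>ennreal\<close>.
  Left continuity at \<open>b\<close> is a condition only when \<open>b\<close> is finite.\<close>

definition young_bound :: "(real \<Rightarrow> ennreal) \<Rightarrow> ereal" where
  "young_bound \<Phi> = (SUP x\<in>{x. 0 < x \<and> \<Phi> x < \<infinity>}. ereal x)"

definition young_function :: "(real \<Rightarrow> ennreal) \<Rightarrow> bool" where
  "young_function \<Phi> \<longleftrightarrow>
     (\<forall>x y t. 0 \<le> t \<and> t \<le> 1 \<longrightarrow>
        \<Phi> ((1 - t) * x + t * y) \<le> ennreal (1 - t) * \<Phi> x + ennreal t * \<Phi> y) \<and>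
     (\<forall>x. \<Phi> (- x) = \<Phi> x) \<and>
     \<Phi> 0 = 0 \<and>
     (\<exists>x>0. \<Phi> x \<noteq> 0) \<and>
     (\<exists>x>0. \<Phi> x \<noteq> \<infinity>) \<and>
     (\<forall>b::real. young_bound \<Phi> = ereal b \<longrightarrow> (\<Phi> \<longlongrightarrow> \<Phi> b) (at_left b))"

text \<open>Subtraction in \<^typ>\<open>ennreal\<close> truncates at \<open>0\<close>. This does not change the supremum, because the
  term for \<open>x = 0\<close> is \<open>0\<close> for every Young function; terms with \<open>\<Phi> x = \<infinity>\<close>, which are \<open>-\<infinity>\<close> in the
  extended reals, become \<open>0\<close>.\<close>

definition complementary :: "(real \<Rightarrow> ennreal) \<Rightarrow> real \<Rightarrow> ennreal" where
  "complementary \<Phi> y = (SUP x\<in>{0..}. ennreal (x * \<bar>y\<bar>) - \<Phi> x)"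

definition gen_inverse :: "(real \<Rightarrow> ennreal) \<Rightarrow> ennreal \<Rightarrow> ennreal" where
  "gen_inverse \<Phi> y = (INF x\<in>{x. 0 \<le> x \<and> \<Phi> x > y}. ennreal x)"

subsection \<open>Orlicz spaces\<close>

definition orlicz :: "'a measure \<Rightarrow> (real \<Rightarrow> ennreal) \<Rightarrow> ('a \<Rightarrow> complex) set" where
  "orlicz M \<Phi> = {f \<in> borel_measurable M. \<exists>k>0. (\<integral>\<^sup>+x. \<Phi> (k * cmod (f x)) \<partial>M) < \<infinity>}"

definition orlicz_norm :: "'a measure \<Rightarrow> (real \<Rightarrow> ennreal) \<Rightarrow> ('a \<Rightarrow> complex) \<Rightarrow> real" where
  "orlicz_norm M \<Phi> f = Inf {k. 0 < k \<and> (\<integral>\<^sup>+x. \<Phi> (cmod (f x) / k) \<partial>M) \<le> 1}"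

definition orlicz_bounded ::
  "'a measure \<Rightarrow> (real \<Rightarrow> ennreal) \<Rightarrow> (('a \<Rightarrow> complex) \<Rightarrow> ('a \<Rightarrow> complex)) \<Rightarrow> bool" where
  "orlicz_bounded M \<Phi> S \<longleftrightarrow>
     (\<forall>f\<in>orlicz M \<Phi>. S f \<in> orlicz M \<Phi>) \<and>
     (\<exists>C. \<forall>f\<in>orlicz M \<Phi>. orlicz_norm M \<Phi> (S f) \<le> C * orlicz_norm M \<Phi> f)"

definition orlicz_range ::
  "'a measure \<Rightarrow> (real \<Rightarrow> ennreal) \<Rightarrow> (('a \<Rightarrow> complex) \<Rightarrow> ('a \<Rightarrow> complex)) \<Rightarrow> ('a \<Rightarrow> complex) set" where
  "orlicz_range M \<Phi> S = {g \<in> borel_measurable M. \<exists>f\<in>orlicz M \<Phi>. AE x in M. g x = S f x}"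

definition orlicz_null_space ::
  "'a measure \<Rightarrow> (real \<Rightarrow> ennreal) \<Rightarrow> (('a \<Rightarrow> complex) \<Rightarrow> ('a \<Rightarrow> complex)) \<Rightarrow> ('a \<Rightarrow> complex) set" where
  "orlicz_null_space M \<Phi> S = {f \<in> orlicz M \<Phi>. AE x in M. S f x = 0}"

text \<open>Closedness of \<open>A\<close> for the norm: every point of the space that is adherent to \<open>A\<close> is in \<open>A\<close>.\<close>

definition orlicz_closed :: "'a measure \<Rightarrow> (real \<Rightarrow> ennreal) \<Rightarrow> ('a \<Rightarrow> complex) set \<Rightarrow> bool" where
  "orlicz_closed M \<Phi> A \<longleftrightarrow> A \<subseteq> orlicz M \<Phi> \<and>
     (\<forall>h\<in>orlicz M \<Phi>. (\<forall>e>0. \<exists>g\<in>A. orlicz_norm M \<Phi> (\<lambda>x. h x - g x) < e) \<longrightarrow> h \<in> A)"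

text \<open>\<open>V = A \<oplus> B\<close> for sets of representatives: \<open>V = A + B\<close> and \<open>A \<inter> B = {0}\<close>, almost everywhere.\<close>

definition ae_direct_sum ::
  "'a measure \<Rightarrow> ('a \<Rightarrow> complex) set \<Rightarrow> ('a \<Rightarrow> complex) set \<Rightarrow> ('a \<Rightarrow> complex) set \<Rightarrow> bool" where
  "ae_direct_sum M V A B \<longleftrightarrow>
     V = {h \<in> borel_measurable M. \<exists>f\<in>A. \<exists>g\<in>B. AE x in M. h x = f x + g x} \<and>
     A \<inter> B = {h \<in> borel_measurable M. AE x in M. h x = 0}"

subsection \<open>Conditional expectation of complex functions and weighted conditional type operators\<close>

definition cond_exp_defined :: "'a measure \<Rightarrow> 'a measure \<Rightarrow> ('a \<Rightarrow> complex) \<Rightarrow> bool" where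
  "cond_exp_defined M F f \<longleftrightarrow> f \<in> borel_measurable M \<and>
     (AE x in M. nn_cond_exp M F (\<lambda>x. ennreal (cmod (f x))) x < \<infinity>)"

text \<open>\<^term>\<open>real_cond_exp\<close> is the difference of the conditional expectations of the positive and the
  negative part. So the next definition is the extension by linearity whenever
  \<^term>\<open>cond_exp_defined M F f\<close>, even if \<open>f\<close> is not integrable; otherwise it is a junk value.\<close>

definition complex_cond_exp :: "'a measure \<Rightarrow> 'a measure \<Rightarrow> ('a \<Rightarrow> complex) \<Rightarrow> 'a \<Rightarrow> complex" where
  "complex_cond_exp M F f x =
     Complex (real_cond_exp M F (\<lambda>x. Re (f x)) x) (real_cond_exp M F (\<lambda>x. Im (f x)) x)"

definition wct ::
  "'a measure \<Rightarrow> 'a measure \<Rightarrow> ('a \<Rightarrow> complex) \<Rightarrow> ('a \<Rightarrow> complex) \<Rightarrow> ('a \<Rightarrow> complex) \<Rightarrow> 'a \<Rightarrow> complex" where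
  "wct M F w u f x = w x * complex_cond_exp M F (\<lambda>x. u x * f x) x"

end

theory Submission
  imports Defs
begin

text \<open>
  Put \<open>T f = w E(u f)\<close> and \<open>v = E(u w)\<close>. Everything rests on the identity \<open>T (T f) = v T f\<close> and on
  the fact that \<open>E\<close>, hence \<open>T\<close>, commutes with multiplication by functions that are measurable for the
  subalgebra; together they give \<open>T (b f + d T f) = (b + d v) T f\<close> for all such \<open>b\<close>, \<open>d\<close>
  (\<open>wct_combination\<close>).

  The bound \<open>|v| < 1\<close> holds almost everywhere, not only on the intersection of the two supports: where the inverse
  \<open>\<Phi>\<^sup>-\<^sup>1(E(\<Phi>(w)))\<close> vanishes, \<open>E(\<Phi>(w))\<close> vanishes and \<open>\<Phi>\<close> is positive on \<open>(0, \<infinity>)\<close>, so that \<open>w = 0\<close> and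
  thus \<open>v = 0\<close>; likewise \<open>u = 0\<close> where the other inverse vanishes
  (\<open>complex_cond_exp_zero_where_gen_inverse_zero\<close>).

  If \<open>f = T f\<close>, then \<open>T f = T (T f) = v T f\<close>, and \<open>v \<noteq> 1\<close> forces \<open>T f = 0 = f\<close>. So the null space of
  \<open>I - T\<close> is zero, and it must be shown that \<open>I - T\<close> is onto (\<open>orlicz_range_eq_orlicz\<close>). The only
  candidate for a solution of \<open>h - T h = g\<close> is \<open>h = g + T g / (1 - v)\<close>; the point is that
  \<open>T g / (1 - v)\<close> belongs to the Orlicz space, although \<open>1 - v\<close> may come arbitrarily close to zero.

  The singularity is removed in two halves. The function \<open>|1 - v|\<^sup>1\<^sup>/\<^sup>2 g\<close> is adherent to the range:
  cut off to \<open>{|1 - v| \<ge> \<eta>\<^sup>2}\<close>, it lies in the range because \<open>1 / (1 - v)\<close> is bounded there,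
  and the part cut away is pointwise at most \<open>\<eta> |g|\<close>. By closedness it lies in the range,
  and its solution \<open>f\<close> satisfies \<open>|T f| = |T g| / |1 - v|\<^sup>1\<^sup>/\<^sup>2\<close>. So multiplying \<open>T g\<close> by a factor
  of size \<open>|1 - v|\<^sup>-\<^sup>1\<^sup>/\<^sup>2\<close> stays inside the space, for every \<open>g\<close> in the space. Applying this
  a second time to the function so obtained gives that \<open>v T g / (1 - v)\<close> is in the space, hence
  so is \<open>T g / (1 - v) = T g + v T g / (1 - v)\<close>.
\<close>

section \<open>Star-shaped functions\<close>

text \<open>The common property of a Young function and its complementary function from which everything
  about them is derived: \<open>\<Theta> x / x\<close> is nondecreasing, and \<open>\<Theta>\<close> is finite somewhere on \<open>(0, \<infinity>)\<close>.\<close>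

definition star_shaped :: "(real \<Rightarrow> ennreal) \<Rightarrow> bool" where
  "star_shaped \<Theta> \<longleftrightarrow>
     (\<forall>t x. 0 \<le> t \<and> t \<le> 1 \<and> 0 \<le> x \<longrightarrow> \<Theta> (t * x) \<le> ennreal t * \<Theta> x) \<and> (\<exists>x>0. \<Theta> x < \<infinity>)"

lemma star_shapedD: "star_shaped \<Theta> \<Longrightarrow> 0 \<le> t \<Longrightarrow> t \<le> 1 \<Longrightarrow> 0 \<le> x \<Longrightarrow> \<Theta> (t * x) \<le> ennreal t * \<Theta> x"
  by (simp add: star_shaped_def)

lemma star_shaped_mono:
  assumes "star_shaped \<Theta>" "0 \<le> x" "x \<le> y"
  shows "\<Theta> x \<le> \<Theta> y"
proof (cases "y = 0")
  case False
  then have "\<Theta> (x / y * y) \<le> ennreal (x / y) * \<Theta> y"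
    using assms by (intro star_shapedD) auto
  also have "\<dots> \<le> ennreal 1 * \<Theta> y"
    using assms False by (intro mult_right_mono ennreal_leI) auto
  finally show ?thesis using False by simp
qed (use assms in auto)

lemma star_shaped_small:
  assumes "star_shaped \<Theta>" and e: "0 < (e::ennreal)"
  shows "\<exists>x>0. \<Theta> x < e"
proof -
  obtain y where y: "y > 0" "\<Theta> y < \<infinity>" using assms by (auto simp: star_shaped_def)
  have "((\<lambda>t. ennreal t * \<Theta> y) \<longlongrightarrow> ennreal 0 * \<Theta> y) (at_right 0)"
    using y by (intro tendsto_mult_ennreal tendsto_intros tendsto_ennrealI) auto
  then have "\<forall>\<^sub>F t in at_right 0. ennreal t * \<Theta> y < e"
    using e by (intro order_tendstoD) auto
  moreover have "\<forall>\<^sub>F t in at_right 0. t \<in> {0<..<1::real}"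
    by (rule eventually_at_right_real) simp
  ultimately have "\<forall>\<^sub>F t in at_right 0. ennreal t * \<Theta> y < e \<and> t \<in> {0<..<1::real}"
    by (rule eventually_conj)
  then obtain t :: real where t: "ennreal t * \<Theta> y < e" "0 < t" "t < 1"
    using eventually_happens'[OF trivial_limit_at_right_real] by fastforce
  have "\<Theta> (t * y) \<le> ennreal t * \<Theta> y"
    using assms t y by (intro star_shapedD) auto
  with t y show ?thesis by (intro exI[of _ "t * y"]) auto
qed

lemma star_shaped_measurable:
  assumes "star_shaped \<Theta>" and [measurable]: "f \<in> borel_measurable M" and "\<And>x. 0 \<le> f x"
  shows "(\<lambda>x. \<Theta> (f x)) \<in> borel_measurable M"
proof -
  have "mono (\<lambda>x. \<Theta> (max 0 x))"
    by (intro monoI star_shaped_mono[OF assms(1)]) auto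
  then have "is_interval {x. \<Theta> (max 0 x) < y}" for y
    unfolding is_interval_1 mono_def by (metis (mono_tags, lifting) le_less_trans mem_Collect_eq)
  then have "(\<lambda>x. \<Theta> (max 0 x)) \<in> borel_measurable borel"
    by (intro borel_measurableI_less) (auto intro: real_interval_borel_measurable)
  from measurable_compose[OF assms(2) this] show ?thesis
    using assms(3) by (simp add: max_def)
qed

lemma star_shaped_young:
  assumes "young_function \<Phi>"
  shows "star_shaped \<Phi>"
proof -
  have conv: "\<Phi> ((1 - t) * 0 + t * x) \<le> ennreal (1 - t) * \<Phi> 0 + ennreal t * \<Phi> x"
    if "0 \<le> t" "t \<le> 1" for t x
    using assms that unfolding young_function_def by blast
  have "\<Phi> 0 = 0" using assms unfolding young_function_def by blast
  with conv have "\<Phi> (t * x) \<le> ennreal t * \<Phi> x" if "0 \<le> t" "t \<le> 1" for t x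
    using that by simp
  moreover obtain x where "x > 0" "\<Phi> x < \<infinity>"
    using assms unfolding young_function_def less_top infinity_ennreal_def by blast
  ultimately show ?thesis by (auto simp: star_shaped_def)
qed

text \<open>The finiteness part holds because \<open>\<Phi>\<close> grows at least linearly: beyond a point \<open>a\<close> with
  \<open>\<Phi> a > 0\<close>, star-shapedness gives \<open>\<Phi> x \<ge> b x\<close> for a slope \<open>b > 0\<close>, so only \<open>x \<le> a\<close> contributes to the
  supremum at \<open>b\<close>.\<close>

lemma star_shaped_complementary:
  assumes "young_function \<Phi>"
  shows "star_shaped (complementary \<Phi>)"
  unfolding star_shaped_def
proof (intro conjI allI impI)
  fix t y :: real assume t: "0 \<le> t \<and> t \<le> 1 \<and> 0 \<le> y"
  show "complementary \<Phi> (t * y) \<le> ennreal t * complementary \<Phi> y"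
    unfolding complementary_def
  proof (rule SUP_least)
    fix x :: real assume x: "x \<in> {0..}"
    have "ennreal (x * \<bar>t * y\<bar>) - \<Phi> x \<le> ennreal (x * \<bar>t * y\<bar>) - ennreal t * \<Phi> x"
      using t mult_right_mono[of "ennreal t" 1 "\<Phi> x"] by (intro ennreal_minus_mono) auto
    also have "\<dots> = ennreal t * (ennreal (x * \<bar>y\<bar>) - \<Phi> x)"
      using t x by (auto simp: ennreal_right_diff_distrib ennreal_mult[symmetric] abs_mult ac_simps)
    also have "\<dots> \<le> ennreal t * (SUP x\<in>{0..}. ennreal (x * \<bar>y\<bar>) - \<Phi> x)"
      using x by (intro mult_left_mono SUP_upper) auto
    finally show "ennreal (x * \<bar>t * y\<bar>) - \<Phi> x \<le> \<dots>" .
  qed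
next
  obtain a where a: "a > 0" "\<Phi> a \<noteq> 0" using assms unfolding young_function_def by blast
  obtain c where c: "0 < c" "ennreal c \<le> \<Phi> a"
    using a(2) by (metis dense ennreal_cases ennreal_less_zero_iff enn2real_top
        ennreal_eq_0_iff le_less not_gr_zero not_le top_greatest zero_less_one)
  define b where "b = c / a"
  have b: "b > 0" using a c by (simp add: b_def)
  have "complementary \<Phi> b \<le> ennreal (a * b)"
    unfolding complementary_def
  proof (rule SUP_least)
    fix x :: real assume x: "x \<in> {0..}"
    show "ennreal (x * \<bar>b\<bar>) - \<Phi> x \<le> ennreal (a * b)"
    proof (cases "x \<le> a")
      case True
      have "ennreal (x * \<bar>b\<bar>) - \<Phi> x \<le> ennreal (x * \<bar>b\<bar>)" by simp
      also have "\<dots> \<le> ennreal (a * b)" using True b x by (intro ennreal_leI) auto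
      finally show ?thesis .
    next
      case False
      have "ennreal c \<le> \<Phi> (a / x * x)" using c False a by simp
      also have "\<dots> \<le> ennreal (a / x) * \<Phi> x"
        using False a by (intro star_shapedD[OF star_shaped_young[OF assms]]) auto
      finally have "ennreal (x / a) * ennreal c \<le> ennreal (x / a) * (ennreal (a / x) * \<Phi> x)"
        by (rule mult_left_mono) simp
      also have "\<dots> = \<Phi> x"
        using False a by (simp add: mult.assoc[symmetric] ennreal_mult[symmetric])
      finally have "ennreal (x * \<bar>b\<bar>) \<le> \<Phi> x"
        using False a b c by (simp add: b_def ennreal_mult[symmetric])
      then have "ennreal (x * \<bar>b\<bar>) - \<Phi> x = 0"
        by (intro diff_eq_0_ennreal) auto
      then show ?thesis by simp
    qed
  qed
  also have "\<dots> < \<infinity>" by simp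
  finally show "\<exists>x>0. complementary \<Phi> x < \<infinity>" using b by blast
qed

text \<open>Since \<open>\<Theta>\<close> tends to zero at zero, a generalized inverse can vanish only at \<open>0\<close>, and there only if
  \<open>\<Theta>\<close> does not vanish on an interval \<open>[0, x]\<close> with \<open>x > 0\<close>.\<close>

lemma gen_inverse_eq_0D:
  assumes "star_shaped \<Theta>" "gen_inverse \<Theta> y = 0"
  shows "y = 0" and "\<And>x. 0 < x \<Longrightarrow> \<Theta> x > 0"
proof -
  have less: "y < \<Theta> x" if "0 < x" for x
  proof -
    have "gen_inverse \<Theta> y < ennreal x" using assms that by simp
    then obtain z where "0 \<le> z" "y < \<Theta> z" "ennreal z < ennreal x"
      unfolding gen_inverse_def INF_less_iff by auto
    then show ?thesis
      using star_shaped_mono[OF assms(1), of z x] by (auto simp: ennreal_less_iff)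
  qed
  show "y = 0"
    using star_shaped_small[OF assms(1), of y] less by (metis less_asym not_gr_zero)
  show "\<Theta> x > 0" if "0 < x" for x
    using less[OF that] by (metis not_gr_zero not_less_zero)
qed

section \<open>Orlicz spaces\<close>

lemma orlicz_dominated:
  assumes "young_function \<Phi>" "f \<in> orlicz M \<Phi>" "g \<in> borel_measurable M"
    and le: "AE x in M. cmod (g x) \<le> C * cmod (f x)"
  shows "g \<in> orlicz M \<Phi>"
proof -
  obtain k where k: "k > 0" "(\<integral>\<^sup>+x. \<Phi> (k * cmod (f x)) \<partial>M) < \<infinity>"
    using assms(2) by (auto simp: orlicz_def)
  define D where "D = max C 1"
  have D: "D > 0" by (simp add: D_def)
  have "(\<integral>\<^sup>+x. \<Phi> (k / D * cmod (g x)) \<partial>M) \<le> (\<integral>\<^sup>+x. \<Phi> (k * cmod (f x)) \<partial>M)"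
  proof (rule nn_integral_mono_AE, rule AE_mp[OF le], intro AE_I2 impI star_shaped_mono[OF star_shaped_young[OF assms(1)]])
    fix x assume "cmod (g x) \<le> C * cmod (f x)"
    also have "\<dots> \<le> D * cmod (f x)" by (intro mult_right_mono) (auto simp: D_def)
    finally have "cmod (g x) / D \<le> cmod (f x)" using D by (simp add: field_simps)
    then have "k * (cmod (g x) / D) \<le> k * cmod (f x)" using k by (intro mult_left_mono) auto
    then show "k / D * cmod (g x) \<le> k * cmod (f x)" by simp
  qed (use k D in auto)
  with k D assms(3) show ?thesis
    unfolding orlicz_def by (auto intro!: exI[of _ "k / D"] intro: le_less_trans)
qed

lemma orlicz_add:
  assumes "young_function \<Phi>" "f \<in> orlicz M \<Phi>" "g \<in> orlicz M \<Phi>"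
  shows "(\<lambda>x. f x + g x) \<in> orlicz M \<Phi>"
proof -
  note star = star_shaped_young[OF assms(1)]
  have [measurable]: "f \<in> borel_measurable M" "g \<in> borel_measurable M"
    using assms by (auto simp: orlicz_def)
  obtain k where k: "k > 0" "(\<integral>\<^sup>+x. \<Phi> (k * cmod (f x)) \<partial>M) < \<infinity>"
    using assms(2) by (auto simp: orlicz_def)
  obtain l where l: "l > 0" "(\<integral>\<^sup>+x. \<Phi> (l * cmod (g x)) \<partial>M) < \<infinity>"
    using assms(3) by (auto simp: orlicz_def)
  define m where "m = min k l / 2"
  have m: "m > 0" using k l by (simp add: m_def)
  have "\<Phi> (m * cmod (f x + g x)) \<le> \<Phi> (k * cmod (f x)) + \<Phi> (l * cmod (g x))" for x
  proof -
    have "m * cmod (f x + g x) \<le> m * (cmod (f x) + cmod (g x))"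
      using m by (intro mult_left_mono norm_triangle_ineq) auto
    also have "\<dots> = (min k l * cmod (f x) + min k l * cmod (g x)) / 2"
      by (simp add: m_def field_simps)
    also have "\<dots> \<le> (k * cmod (f x) + l * cmod (g x)) / 2"
      by (intro divide_right_mono add_mono mult_right_mono) auto
    also have "\<dots> \<le> max (k * cmod (f x)) (l * cmod (g x))" by (simp add: max_def)
    finally have "\<Phi> (m * cmod (f x + g x)) \<le> \<Phi> (max (k * cmod (f x)) (l * cmod (g x)))"
      using m by (intro star_shaped_mono[OF star]) auto
    also have "\<dots> \<le> \<Phi> (k * cmod (f x)) + \<Phi> (l * cmod (g x))"
      by (simp add: max_def)
    finally show ?thesis .
  qed
  then have "(\<integral>\<^sup>+x. \<Phi> (m * cmod (f x + g x)) \<partial>M)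
      \<le> (\<integral>\<^sup>+x. \<Phi> (k * cmod (f x)) + \<Phi> (l * cmod (g x)) \<partial>M)"
    by (intro nn_integral_mono) auto
  also have "\<dots> = (\<integral>\<^sup>+x. \<Phi> (k * cmod (f x)) \<partial>M) + (\<integral>\<^sup>+x. \<Phi> (l * cmod (g x)) \<partial>M)"
    using k l by (intro nn_integral_add star_shaped_measurable[OF star]) auto
  also have "\<dots> < \<infinity>" using k l by simp
  finally show ?thesis using m unfolding orlicz_def by auto
qed

text \<open>Smallness in norm from pointwise smallness relative to a fixed \<open>f\<close>. If \<open>J\<close> is the integral of
  \<open>\<Phi>(k |f|)\<close>, then scaling \<open>k f\<close> by \<open>t = 1 / (1 + J)\<close> brings the integral down to at most \<open>1\<close> by
  star-shapedness, so \<open>K = 1 / (t k)\<close> will do.\<close>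

lemma orlicz_norm_dominated:
  assumes "young_function \<Phi>" "f \<in> orlicz M \<Phi>"
  obtains K where "0 < K" and
    "\<And>g e. 0 < e \<Longrightarrow> (AE x in M. cmod (g x) \<le> e * cmod (f x)) \<Longrightarrow> orlicz_norm M \<Phi> g \<le> e * K"
proof -
  note star = star_shaped_young[OF assms(1)]
  have [measurable]: "f \<in> borel_measurable M"
    using assms by (auto simp: orlicz_def)
  obtain k where k: "k > 0" "(\<integral>\<^sup>+x. \<Phi> (k * cmod (f x)) \<partial>M) < \<infinity>"
    using assms(2) by (auto simp: orlicz_def)
  define J where "J = enn2real (\<integral>\<^sup>+x. \<Phi> (k * cmod (f x)) \<partial>M)"
  have J: "(\<integral>\<^sup>+x. \<Phi> (k * cmod (f x)) \<partial>M) = ennreal J" "J \<ge> 0"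
    using k by (auto simp: J_def)
  define t where "t = 1 / (1 + J)"
  have t: "0 < t" "t \<le> 1" "t * J \<le> 1" using J by (auto simp: t_def divide_le_eq)
  define K where "K = 1 / (t * k)"
  have K: "0 < K" using t k by (simp add: K_def)
  show ?thesis
  proof (rule that[OF K])
    fix g e assume e: "(0::real) < e" and le: "AE x in M. cmod (g x) \<le> e * cmod (f x)"
    have "(\<integral>\<^sup>+x. \<Phi> (cmod (g x) / (e * K)) \<partial>M) \<le> (\<integral>\<^sup>+x. ennreal t * \<Phi> (k * cmod (f x)) \<partial>M)"
    proof (rule nn_integral_mono_AE, rule AE_mp[OF le], intro AE_I2 impI)
      fix x assume "cmod (g x) \<le> e * cmod (f x)"
      then have "cmod (g x) / e \<le> cmod (f x)" using e by (simp add: divide_le_eq mult.commute)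
      then have "t * k * (cmod (g x) / e) \<le> t * k * cmod (f x)"
        using t k by (intro mult_left_mono) auto
      then have "cmod (g x) / (e * K) \<le> t * (k * cmod (f x))"
        by (simp add: K_def mult_ac)
      then have "\<Phi> (cmod (g x) / (e * K)) \<le> \<Phi> (t * (k * cmod (f x)))"
        using e K by (intro star_shaped_mono[OF star]) auto
      also have "\<dots> \<le> ennreal t * \<Phi> (k * cmod (f x))"
        using t k by (intro star_shapedD[OF star]) auto
      finally show "\<Phi> (cmod (g x) / (e * K)) \<le> ennreal t * \<Phi> (k * cmod (f x))" .
    qed
    also have "\<dots> = ennreal t * (\<integral>\<^sup>+x. \<Phi> (k * cmod (f x)) \<partial>M)"
      using k by (intro nn_integral_cmult star_shaped_measurable[OF star]) auto
    also have "\<dots> = ennreal (t * J)" using t J by (simp add: ennreal_mult)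
    also have "\<dots> \<le> 1" using t by simp
    finally show "orlicz_norm M \<Phi> g \<le> e * K"
      unfolding orlicz_norm_def using e K by (intro cInf_lower bdd_belowI[of _ 0]) auto
  qed
qed


section \<open>Conditional expectation without integrability\<close>

text \<open>The products \<open>u f\<close> need not be integrable; only \<open>E(|u f|) < \<infinity>\<close> almost everywhere is known. So
  linearity is derived from the additivity of the nonnegative conditional expectation, which
  holds without any integrability.\<close>

lemma borel_measurable_Complex [measurable]:
  assumes [measurable]: "f \<in> borel_measurable M" "g \<in> borel_measurable M"
  shows "(\<lambda>x. Complex (f x) (g x)) \<in> borel_measurable M"
  by (simp add: Complex_eq)

lemma borel_measurable_complex_cond_exp [measurable]:
  "complex_cond_exp M F f \<in> borel_measurable F"
  unfolding complex_cond_exp_def by measurable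

context sigma_finite_subalgebra
begin

text \<open>Any decomposition into nonnegative parts with finite expectation may replace the positive and
  the negative part: the equation \<open>f\<^sup>+ + q = f\<^sup>- + p\<close> contains no subtraction, so \<open>E\<close> respects it, and
  the finite terms can then be moved across.\<close>

lemma real_cond_exp_as_difference:
  assumes [measurable]: "f \<in> borel_measurable M" "p \<in> borel_measurable M" "q \<in> borel_measurable M"
    and nonneg: "\<And>x. 0 \<le> p x" "\<And>x. 0 \<le> q x" and f: "\<And>x. f x = p x - q x"
    and fin_p: "AE x in M. nn_cond_exp M F (\<lambda>x. ennreal (p x)) x < \<infinity>"
    and fin_q: "AE x in M. nn_cond_exp M F (\<lambda>x. ennreal (q x)) x < \<infinity>"
  shows "AE x in M. real_cond_exp M F f x =
    enn2real (nn_cond_exp M F (\<lambda>x. ennreal (p x)) x) - enn2real (nn_cond_exp M F (\<lambda>x. ennreal (q x)) x)"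
proof -
  let ?E = "\<lambda>g. nn_cond_exp M F (\<lambda>x. ennreal (g x))"
  have eq: "ennreal (f x) + ennreal (q x) = ennreal (- f x) + ennreal (p x)" for x
    using nonneg[of x] by (cases "p x \<le> q x") (auto simp: f ennreal_neg ennreal_plus[symmetric] simp del: ennreal_plus)
  have "AE x in M. ?E f x + ?E q x = nn_cond_exp M F (\<lambda>x. ennreal (f x) + ennreal (q x)) x"
    by (intro nn_cond_exp_sum) auto
  moreover have "AE x in M. ?E (\<lambda>x. - f x) x + ?E p x
      = nn_cond_exp M F (\<lambda>x. ennreal (- f x) + ennreal (p x)) x"
    by (intro nn_cond_exp_sum) auto
  moreover have "AE x in M. ?E f x \<le> ?E p x"
    using nonneg by (intro nn_cond_exp_mono) (auto simp: f intro!: ennreal_leI)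
  moreover have "AE x in M. ?E (\<lambda>x. - f x) x \<le> ?E q x"
    using nonneg by (intro nn_cond_exp_mono) (auto simp: f intro!: ennreal_leI)
  ultimately show ?thesis
    using fin_p fin_q
  proof eventually_elim
    case (elim x)
    have "enn2real a - enn2real b = enn2real c - enn2real d"
      if "a + d = b + c" "a \<le> c" "b \<le> d" "c < \<infinity>" "d < \<infinity>" for a b c d :: ennreal
    proof -
      have "enn2real a + enn2real d = enn2real b + enn2real c"
        using that by (metis enn2real_plus infinity_ennreal_def order_le_less_trans)
      then show ?thesis by simp
    qed
    with elim show ?case unfolding real_cond_exp_def eq by metis
  qed
qed

lemma nn_cond_exp_parts_finite:
  assumes [measurable]: "f \<in> borel_measurable M"
    and fin: "AE x in M. nn_cond_exp M F (\<lambda>x. ennreal \<bar>f x\<bar>) x < \<infinity>"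
  shows "AE x in M. nn_cond_exp M F (\<lambda>x. ennreal (f x)) x < \<infinity>"
    and "AE x in M. nn_cond_exp M F (\<lambda>x. ennreal (- f x)) x < \<infinity>"
proof -
  have "AE x in M. nn_cond_exp M F (\<lambda>x. ennreal (f x)) x \<le> nn_cond_exp M F (\<lambda>x. ennreal \<bar>f x\<bar>) x"
    by (intro nn_cond_exp_mono) (auto intro!: ennreal_leI)
  with fin show "AE x in M. nn_cond_exp M F (\<lambda>x. ennreal (f x)) x < \<infinity>"
    by eventually_elim (rule le_less_trans)
  have "AE x in M. nn_cond_exp M F (\<lambda>x. ennreal (- f x)) x \<le> nn_cond_exp M F (\<lambda>x. ennreal \<bar>f x\<bar>) x"
    by (intro nn_cond_exp_mono) (auto intro!: ennreal_leI)
  with fin show "AE x in M. nn_cond_exp M F (\<lambda>x. ennreal (- f x)) x < \<infinity>"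
    by eventually_elim (rule le_less_trans)
qed

lemma real_cond_exp_add_finite:
  assumes [measurable]: "f \<in> borel_measurable M" "g \<in> borel_measurable M"
    and fin: "AE x in M. nn_cond_exp M F (\<lambda>x. ennreal \<bar>f x\<bar>) x < \<infinity>"
      "AE x in M. nn_cond_exp M F (\<lambda>x. ennreal \<bar>g x\<bar>) x < \<infinity>"
  shows "AE x in M. real_cond_exp M F (\<lambda>x. f x + g x) x = real_cond_exp M F f x + real_cond_exp M F g x"
proof -
  let ?E = "\<lambda>g. nn_cond_exp M F (\<lambda>x. ennreal (g x))"
  define p where "p = (\<lambda>x. max (f x) 0 + max (g x) 0)"
  define q where "q = (\<lambda>x. max (- f x) 0 + max (- g x) 0)"
  have [measurable]: "p \<in> borel_measurable M" "q \<in> borel_measurable M"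
    unfolding p_def q_def by measurable
  have pq: "ennreal (p x) = ennreal (f x) + ennreal (g x)"
    "ennreal (q x) = ennreal (- f x) + ennreal (- g x)" for x
    unfolding p_def q_def by (simp_all add: max_def ennreal_neg)
  note parts = nn_cond_exp_parts_finite[OF _ fin(1)] nn_cond_exp_parts_finite[OF _ fin(2)]
  have E_p: "AE x in M. ?E f x + ?E g x = ?E p x"
    unfolding pq by (intro nn_cond_exp_sum) auto
  have E_q: "AE x in M. ?E (\<lambda>x. - f x) x + ?E (\<lambda>x. - g x) x = ?E q x"
    unfolding pq by (intro nn_cond_exp_sum) auto
  have fin_fg: "AE x in M. ?E f x < \<infinity>" "AE x in M. ?E g x < \<infinity>"
    "AE x in M. ?E (\<lambda>x. - f x) x < \<infinity>" "AE x in M. ?E (\<lambda>x. - g x) x < \<infinity>"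
    using parts by auto
  have "AE x in M. real_cond_exp M F (\<lambda>x. f x + g x) x = enn2real (?E p x) - enn2real (?E q x)"
  proof (rule real_cond_exp_as_difference)
    show "AE x in M. ?E p x < \<infinity>"
      using E_p fin_fg(1,2) by eventually_elim (metis ennreal_add_less_top infinity_ennreal_def)
    show "AE x in M. ?E q x < \<infinity>"
      using E_q fin_fg(3,4) by eventually_elim (metis ennreal_add_less_top infinity_ennreal_def)
  qed (auto simp: p_def q_def max_def)
  then show ?thesis
    using fin_fg E_p E_q
  proof eventually_elim
    case (elim x)
    have "real_cond_exp M F (\<lambda>x. f x + g x) x = enn2real (?E f x + ?E g x)
        - enn2real (?E (\<lambda>x. - f x) x + ?E (\<lambda>x. - g x) x)"
      unfolding elim(6,7) by (rule elim(1))
    then show ?case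
      using elim(2-5) by (simp add: enn2real_plus real_cond_exp_def[of M F f] real_cond_exp_def[of M F g])
  qed
qed

lemma real_cond_exp_mult_finite:
  assumes c[measurable]: "c \<in> borel_measurable F" and [measurable]: "f \<in> borel_measurable M"
    and fin: "AE x in M. nn_cond_exp M F (\<lambda>x. ennreal \<bar>f x\<bar>) x < \<infinity>"
  shows "AE x in M. real_cond_exp M F (\<lambda>x. c x * f x) x = c x * real_cond_exp M F f x"
proof -
  have [measurable]: "c \<in> borel_measurable M" by (rule measurable_from_subalg[OF subalg c])
  let ?E = "\<lambda>g. nn_cond_exp M F (\<lambda>x. ennreal (g x))"
  define p where "p = (\<lambda>x. max (c x) 0 * max (f x) 0 + max (- c x) 0 * max (- f x) 0)"
  define q where "q = (\<lambda>x. max (c x) 0 * max (- f x) 0 + max (- c x) 0 * max (f x) 0)"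
  have [measurable]: "p \<in> borel_measurable M" "q \<in> borel_measurable M"
    unfolding p_def q_def by measurable
  have prod_parts: "ennreal (max a 0 * max b 0) = ennreal a * ennreal b" for a b :: real
    by (cases "0 \<le> a"; cases "0 \<le> b") (simp_all add: max_def ennreal_mult ennreal_neg)
  have pq: "ennreal (p x) = ennreal (c x) * ennreal (f x) + ennreal (- c x) * ennreal (- f x)"
    "ennreal (q x) = ennreal (c x) * ennreal (- f x) + ennreal (- c x) * ennreal (f x)" for x
    unfolding p_def q_def by (simp_all only: ennreal_plus mult_nonneg_nonneg max.cobounded2 prod_parts)
  note parts = nn_cond_exp_parts_finite[OF _ fin]
  have prod: "AE x in M. ennreal (d x) * ?E g x = nn_cond_exp M F (\<lambda>x. ennreal (d x) * ennreal (g x)) x"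
    if "d \<in> borel_measurable F" "g \<in> borel_measurable M" for d g
    using that by (intro nn_cond_exp_prod) auto
  have E_p: "AE x in M. ennreal (c x) * ?E f x + ennreal (- c x) * ?E (\<lambda>x. - f x) x = ?E p x"
  proof -
    have "AE x in M. nn_cond_exp M F (\<lambda>x. ennreal (c x) * ennreal (f x)) x
        + nn_cond_exp M F (\<lambda>x. ennreal (- c x) * ennreal (- f x)) x = ?E p x"
      unfolding pq by (intro nn_cond_exp_sum) auto
    moreover have "AE x in M. ennreal (c x) * ?E f x = nn_cond_exp M F (\<lambda>x. ennreal (c x) * ennreal (f x)) x"
      by (intro prod) auto
    moreover have "AE x in M. ennreal (- c x) * ?E (\<lambda>x. - f x) x
        = nn_cond_exp M F (\<lambda>x. ennreal (- c x) * ennreal (- f x)) x"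
      by (intro prod) auto
    ultimately show ?thesis by eventually_elim simp
  qed
  have E_q: "AE x in M. ennreal (c x) * ?E (\<lambda>x. - f x) x + ennreal (- c x) * ?E f x = ?E q x"
  proof -
    have "AE x in M. nn_cond_exp M F (\<lambda>x. ennreal (c x) * ennreal (- f x)) x
        + nn_cond_exp M F (\<lambda>x. ennreal (- c x) * ennreal (f x)) x = ?E q x"
      unfolding pq by (intro nn_cond_exp_sum) auto
    moreover have "AE x in M. ennreal (c x) * ?E (\<lambda>x. - f x) x
        = nn_cond_exp M F (\<lambda>x. ennreal (c x) * ennreal (- f x)) x"
      by (intro prod) auto
    moreover have "AE x in M. ennreal (- c x) * ?E f x
        = nn_cond_exp M F (\<lambda>x. ennreal (- c x) * ennreal (f x)) x"
      by (intro prod) auto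
    ultimately show ?thesis by eventually_elim simp
  qed
  have fin_f: "AE x in M. ?E f x < \<infinity>" "AE x in M. ?E (\<lambda>x. - f x) x < \<infinity>"
    using parts by auto
  have "AE x in M. real_cond_exp M F (\<lambda>x. c x * f x) x = enn2real (?E p x) - enn2real (?E q x)"
  proof (rule real_cond_exp_as_difference)
    show "AE x in M. ?E p x < \<infinity>"
      using E_p fin_f by eventually_elim (metis ennreal_add_less_top ennreal_less_top ennreal_mult_less_top infinity_ennreal_def)
    show "AE x in M. ?E q x < \<infinity>"
      using E_q fin_f by eventually_elim (metis ennreal_add_less_top ennreal_less_top ennreal_mult_less_top infinity_ennreal_def)
  qed (auto simp: p_def q_def max_def)
  then show ?thesis
    using E_p E_q fin_f
  proof eventually_elim
    case (elim x)
    have "enn2real (?E p x) = enn2real (ennreal (c x)) * enn2real (?E f x)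
        + enn2real (ennreal (- c x)) * enn2real (?E (\<lambda>x. - f x) x)"
      unfolding elim(2)[symmetric] using elim(4,5)
      by (subst enn2real_plus) (auto simp: enn2real_mult ennreal_mult_less_top)
    moreover have "enn2real (?E q x) = enn2real (ennreal (c x)) * enn2real (?E (\<lambda>x. - f x) x)
        + enn2real (ennreal (- c x)) * enn2real (?E f x)"
      unfolding elim(3)[symmetric] using elim(4,5)
      by (subst enn2real_plus) (auto simp: enn2real_mult ennreal_mult_less_top)
    ultimately show ?case
      using elim(1) unfolding real_cond_exp_def
      by (cases "c x \<ge> 0") (auto simp: ennreal_neg algebra_simps)
  qed
qed

lemma cond_exp_defined_parts:
  assumes "cond_exp_defined M F f"
  shows "f \<in> borel_measurable M"
    and "AE x in M. nn_cond_exp M F (\<lambda>x. ennreal \<bar>Re (f x)\<bar>) x < \<infinity>"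
    and "AE x in M. nn_cond_exp M F (\<lambda>x. ennreal \<bar>Im (f x)\<bar>) x < \<infinity>"
proof -
  show [measurable]: "f \<in> borel_measurable M" using assms by (simp add: cond_exp_defined_def)
  have fin: "AE x in M. nn_cond_exp M F (\<lambda>x. ennreal (cmod (f x))) x < \<infinity>"
    using assms by (simp add: cond_exp_defined_def)
  have "AE x in M. nn_cond_exp M F (\<lambda>x. ennreal \<bar>Re (f x)\<bar>) x \<le> nn_cond_exp M F (\<lambda>x. ennreal (cmod (f x))) x"
    by (intro nn_cond_exp_mono) (auto intro!: ennreal_leI abs_Re_le_cmod)
  with fin show "AE x in M. nn_cond_exp M F (\<lambda>x. ennreal \<bar>Re (f x)\<bar>) x < \<infinity>"
    by eventually_elim (rule le_less_trans)
  have "AE x in M. nn_cond_exp M F (\<lambda>x. ennreal \<bar>Im (f x)\<bar>) x \<le> nn_cond_exp M F (\<lambda>x. ennreal (cmod (f x))) x"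
    by (intro nn_cond_exp_mono) (auto intro!: ennreal_leI abs_Im_le_cmod)
  with fin show "AE x in M. nn_cond_exp M F (\<lambda>x. ennreal \<bar>Im (f x)\<bar>) x < \<infinity>"
    by eventually_elim (rule le_less_trans)
qed

lemma cond_exp_defined_mult:
  assumes c[measurable]: "c \<in> borel_measurable F" and f: "cond_exp_defined M F f"
  shows "cond_exp_defined M F (\<lambda>x. c x * f x)"
proof -
  have [measurable]: "c \<in> borel_measurable M" by (rule measurable_from_subalg[OF subalg c])
  have [measurable]: "f \<in> borel_measurable M" by (rule cond_exp_defined_parts[OF f])
  have "AE x in M. ennreal (cmod (c x)) * nn_cond_exp M F (\<lambda>x. ennreal (cmod (f x))) x
      = nn_cond_exp M F (\<lambda>x. ennreal (cmod (c x)) * ennreal (cmod (f x))) x"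
    by (intro nn_cond_exp_prod) auto
  moreover have "AE x in M. nn_cond_exp M F (\<lambda>x. ennreal (cmod (f x))) x < \<infinity>"
    using f by (simp add: cond_exp_defined_def)
  ultimately have "AE x in M. nn_cond_exp M F (\<lambda>x. ennreal (cmod (c x)) * ennreal (cmod (f x))) x < \<infinity>"
    by eventually_elim (metis ennreal_less_top ennreal_mult_less_top infinity_ennreal_def)
  then show ?thesis
    by (simp add: cond_exp_defined_def norm_mult ennreal_mult)
qed

lemma complex_cond_exp_cong:
  assumes "AE x in M. f x = g x" and [measurable]: "f \<in> borel_measurable M" "g \<in> borel_measurable M"
  shows "AE x in M. complex_cond_exp M F f x = complex_cond_exp M F g x"
proof -
  have "AE x in M. real_cond_exp M F (\<lambda>x. Re (f x)) x = real_cond_exp M F (\<lambda>x. Re (g x)) x"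
    using assms(1) by (intro real_cond_exp_cong) auto
  moreover have "AE x in M. real_cond_exp M F (\<lambda>x. Im (f x)) x = real_cond_exp M F (\<lambda>x. Im (g x)) x"
    using assms(1) by (intro real_cond_exp_cong) auto
  ultimately show ?thesis unfolding complex_cond_exp_def by eventually_elim simp
qed

lemma complex_cond_exp_add:
  assumes f: "cond_exp_defined M F f" and g: "cond_exp_defined M F g"
  shows "AE x in M. complex_cond_exp M F (\<lambda>x. f x + g x) x = complex_cond_exp M F f x + complex_cond_exp M F g x"
proof -
  note [measurable] = cond_exp_defined_parts(1)[OF f] cond_exp_defined_parts(1)[OF g]
  have "AE x in M. real_cond_exp M F (\<lambda>x. Re (f x) + Re (g x)) x
      = real_cond_exp M F (\<lambda>x. Re (f x)) x + real_cond_exp M F (\<lambda>x. Re (g x)) x"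
    by (intro real_cond_exp_add_finite cond_exp_defined_parts f g) auto
  moreover have "AE x in M. real_cond_exp M F (\<lambda>x. Im (f x) + Im (g x)) x
      = real_cond_exp M F (\<lambda>x. Im (f x)) x + real_cond_exp M F (\<lambda>x. Im (g x)) x"
    by (intro real_cond_exp_add_finite cond_exp_defined_parts f g) auto
  ultimately show ?thesis
    unfolding complex_cond_exp_def by eventually_elim (simp add: complex_eq_iff)
qed

lemma complex_cond_exp_mult:
  assumes c[measurable]: "c \<in> borel_measurable F" and f: "cond_exp_defined M F f"
  shows "AE x in M. complex_cond_exp M F (\<lambda>x. c x * f x) x = c x * complex_cond_exp M F f x"
proof -
  have [measurable]: "c \<in> borel_measurable M" by (rule measurable_from_subalg[OF subalg c])
  note [measurable] = cond_exp_defined_parts(1)[OF f]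
  have real_mult: "AE x in M. real_cond_exp M F (\<lambda>x. d x * h x) x = d x * real_cond_exp M F h x"
    "AE x in M. nn_cond_exp M F (\<lambda>x. ennreal \<bar>d x * h x\<bar>) x < \<infinity>"
    if [measurable]: "d \<in> borel_measurable F" "h \<in> borel_measurable M"
      and fin: "AE x in M. nn_cond_exp M F (\<lambda>x. ennreal \<bar>h x\<bar>) x < \<infinity>" for d h :: "'a \<Rightarrow> real"
  proof -
    show "AE x in M. real_cond_exp M F (\<lambda>x. d x * h x) x = d x * real_cond_exp M F h x"
      by (intro real_cond_exp_mult_finite fin) auto
    have "cond_exp_defined M F (\<lambda>x. of_real (d x) * of_real (h x))"
      using fin by (intro cond_exp_defined_mult[of "\<lambda>x. of_real (d x)" "\<lambda>x. of_real (h x)"])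
        (simp_all add: cond_exp_defined_def)
    then show "AE x in M. nn_cond_exp M F (\<lambda>x. ennreal \<bar>d x * h x\<bar>) x < \<infinity>"
      by (simp add: cond_exp_defined_def norm_mult abs_mult)
  qed
  have re: "AE x in M. real_cond_exp M F (\<lambda>x. Re (c x) * Re (f x) + (- Im (c x)) * Im (f x)) x
      = real_cond_exp M F (\<lambda>x. Re (c x) * Re (f x)) x + real_cond_exp M F (\<lambda>x. (- Im (c x)) * Im (f x)) x"
    by (intro real_cond_exp_add_finite real_mult(2) cond_exp_defined_parts f) auto
  have im: "AE x in M. real_cond_exp M F (\<lambda>x. Re (c x) * Im (f x) + Im (c x) * Re (f x)) x
      = real_cond_exp M F (\<lambda>x. Re (c x) * Im (f x)) x + real_cond_exp M F (\<lambda>x. Im (c x) * Re (f x)) x"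
    by (intro real_cond_exp_add_finite real_mult(2) cond_exp_defined_parts f) auto
  have "AE x in M. real_cond_exp M F (\<lambda>x. Re (c x) * Re (f x)) x = Re (c x) * real_cond_exp M F (\<lambda>x. Re (f x)) x"
    "AE x in M. real_cond_exp M F (\<lambda>x. (- Im (c x)) * Im (f x)) x = (- Im (c x)) * real_cond_exp M F (\<lambda>x. Im (f x)) x"
    "AE x in M. real_cond_exp M F (\<lambda>x. Re (c x) * Im (f x)) x = Re (c x) * real_cond_exp M F (\<lambda>x. Im (f x)) x"
    "AE x in M. real_cond_exp M F (\<lambda>x. Im (c x) * Re (f x)) x = Im (c x) * real_cond_exp M F (\<lambda>x. Re (f x)) x"
    by (intro real_mult(1) cond_exp_defined_parts f; measurable)+
  with re im show ?thesis
    unfolding complex_cond_exp_def by eventually_elim (simp add: complex_eq_iff)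
qed

text \<open>On the set where \<open>E(\<Theta>(f)) = 0\<close>, which belongs to the subalgebra, the integral of \<open>\<Theta>(f)\<close> is the
  integral of \<open>E(\<Theta>(f))\<close>, hence zero.\<close>

lemma zero_where_gen_inverse_nn_cond_exp_zero:
  assumes \<Theta>: "star_shaped \<Theta>" and [measurable]: "f \<in> borel_measurable M"
  shows "AE x in M. gen_inverse \<Theta> (nn_cond_exp M F (\<lambda>x. \<Theta> (cmod (f x))) x) = 0 \<longrightarrow>
    f x = 0"
proof -
  define e where "e = nn_cond_exp M F (\<lambda>x. \<Theta> (cmod (f x)))"
  have [measurable]: "e \<in> borel_measurable F" unfolding e_def by measurable
  have [measurable]: "e \<in> borel_measurable M" unfolding e_def by measurable
  have [measurable]: "(\<lambda>x. \<Theta> (cmod (f x))) \<in> borel_measurable M"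
    by (intro star_shaped_measurable[OF \<Theta>]) auto
  let ?B = "\<lambda>x. indicator {0} (e x) :: ennreal"
  have "(\<integral>\<^sup>+x. ?B x * \<Theta> (cmod (f x)) \<partial>M) = (\<integral>\<^sup>+x. ?B x * e x \<partial>M)"
    unfolding e_def[symmetric] by (subst nn_cond_exp_intg[symmetric]) (auto simp: e_def)
  also have "\<dots> = 0" by (simp add: nn_integral_0_iff_AE indicator_def)
  finally have "AE x in M. ?B x * \<Theta> (cmod (f x)) = 0" by (subst (asm) nn_integral_0_iff_AE) auto
  then show ?thesis
    unfolding e_def[symmetric]
  proof eventually_elim
    case (elim x)
    show ?case
    proof
      assume "gen_inverse \<Theta> (e x) = 0"
      note * = gen_inverse_eq_0D[OF \<Theta> this]
      with elim have "\<Theta> (cmod (f x)) = 0" by simp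
      with * show "f x = 0" by (metis less_irrefl zero_less_norm_iff)
    qed
  qed
qed

lemma complex_cond_exp_zero_on:
  assumes B[measurable]: "B \<in> sets F" and f: "cond_exp_defined M F f"
    and zero: "AE x in M. x \<in> B \<longrightarrow> f x = 0"
  shows "AE x in M. x \<in> B \<longrightarrow> complex_cond_exp M F f x = 0"
proof -
  have [measurable]: "B \<in> sets M" using B subalg by (auto simp: subalgebra_def)
  note [measurable] = cond_exp_defined_parts(1)[OF f]
  have "AE x in M. complex_cond_exp M F (\<lambda>x. indicator B x * f x) x = indicator B x * complex_cond_exp M F f x"
    by (intro complex_cond_exp_mult f) auto
  moreover have "AE x in M. complex_cond_exp M F (\<lambda>x. indicator B x * f x) x = complex_cond_exp M F (\<lambda>x. 0 * f x) x"
    using zero by (intro complex_cond_exp_cong) (auto elim!: AE_mp intro!: AE_I2 simp: indicator_def)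
  moreover have "AE x in M. complex_cond_exp M F (\<lambda>x. 0 * f x) x = 0 * complex_cond_exp M F f x"
    by (intro complex_cond_exp_mult f) auto
  ultimately show ?thesis by eventually_elim (auto simp: indicator_def split: if_splits)
qed


text \<open>Applied to \<open>g = u w\<close> with \<open>f = w\<close> or \<open>f = u\<close>, this shows that \<open>E(u w)\<close> vanishes
  outside the intersection of the two supports.
  The case distinction keeps the exceptional set inside the subalgebra: the generalized inverse
  vanishes at \<open>y\<close> only if \<open>y = 0\<close>, so the set is either empty or all of \<open>{E(\<Theta>(f)) = 0}\<close>.\<close>

lemma complex_cond_exp_zero_where_gen_inverse_zero:
  assumes \<Theta>: "star_shaped \<Theta>" and f: "f \<in> borel_measurable M"
    and g: "cond_exp_defined M F g" and fg: "\<And>x. f x = 0 \<Longrightarrow> g x = 0"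
  shows "AE x in M. gen_inverse \<Theta> (nn_cond_exp M F (\<lambda>x. \<Theta> (cmod (f x))) x) = 0 \<longrightarrow>
    complex_cond_exp M F g x = 0"
proof (cases "gen_inverse \<Theta> 0 = 0")
  case True
  define B where "B = {x \<in> space F. nn_cond_exp M F (\<lambda>x. \<Theta> (cmod (f x))) x = 0}"
  have space: "space F = space M" using subalg by (simp add: subalgebra_def)
  have "B \<in> sets F" unfolding B_def by measurable
  moreover have "AE x in M. x \<in> B \<longrightarrow> g x = 0"
    using zero_where_gen_inverse_nn_cond_exp_zero[OF \<Theta> f]
    by eventually_elim (auto simp: B_def True fg)
  ultimately have "AE x in M. x \<in> B \<longrightarrow> complex_cond_exp M F g x = 0"
    by (intro complex_cond_exp_zero_on g)
  with AE_space show ?thesis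
    by eventually_elim (auto simp: B_def space dest: gen_inverse_eq_0D(1)[OF \<Theta>])
next
  case False
  then show ?thesis
    by (intro AE_I2 impI) (metis gen_inverse_eq_0D(1)[OF \<Theta>])
qed

section \<open>Weighted conditional type operators\<close>

lemma wct_measurable [measurable]:
  assumes [measurable]: "w \<in> borel_measurable M"
  shows "wct M F w u f \<in> borel_measurable M"
proof -
  have [measurable]: "complex_cond_exp M F (\<lambda>x. u x * f x) \<in> borel_measurable M"
    by (rule measurable_from_subalg[OF subalg]) simp
  show ?thesis unfolding wct_def by measurable
qed

lemma wct_cong:
  assumes "AE x in M. f x = g x"
    and [measurable]: "f \<in> borel_measurable M" "g \<in> borel_measurable M" "u \<in> borel_measurable M"
  shows "AE x in M. wct M F w u f x = wct M F w u g x"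
proof -
  have "AE x in M. complex_cond_exp M F (\<lambda>x. u x * f x) x = complex_cond_exp M F (\<lambda>x. u x * g x) x"
    using assms(1) by (intro complex_cond_exp_cong) auto
  then show ?thesis unfolding wct_def by eventually_elim simp
qed

text \<open>Module linearity of \<open>E\<close> over the functions measurable for the subalgebra: \<open>E(u g)\<close> is itself such
  a function, so in \<open>E(u d w E(u g))\<close> it can be pulled out together with \<open>d\<close>, leaving \<open>E(u w)\<close>.\<close>

lemma wct_combination:
  assumes [measurable]: "b \<in> borel_measurable F" "d \<in> borel_measurable F"
    and uw: "cond_exp_defined M F (\<lambda>x. u x * w x)" and ug: "cond_exp_defined M F (\<lambda>x. u x * g x)"
  shows "AE x in M. wct M F w u (\<lambda>x. b x * g x + d x * wct M F w u g x) x =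
    (b x + d x * complex_cond_exp M F (\<lambda>x. u x * w x) x) * wct M F w u g x"
proof -
  define e where "e = complex_cond_exp M F (\<lambda>x. u x * g x)"
  have [measurable]: "e \<in> borel_measurable F" unfolding e_def by measurable
  have eq: "(\<lambda>x. u x * (b x * g x + d x * wct M F w u g x))
      = (\<lambda>x. b x * (u x * g x) + (d x * e x) * (u x * w x))"
    by (simp add: wct_def e_def algebra_simps)
  have "AE x in M. complex_cond_exp M F (\<lambda>x. b x * (u x * g x) + (d x * e x) * (u x * w x)) x
      = complex_cond_exp M F (\<lambda>x. b x * (u x * g x)) x + complex_cond_exp M F (\<lambda>x. (d x * e x) * (u x * w x)) x"
    by (intro complex_cond_exp_add cond_exp_defined_mult uw ug) auto
  moreover have "AE x in M. complex_cond_exp M F (\<lambda>x. b x * (u x * g x)) x = b x * e x"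
    unfolding e_def by (intro complex_cond_exp_mult ug) auto
  moreover have "AE x in M. complex_cond_exp M F (\<lambda>x. (d x * e x) * (u x * w x)) x
      = (d x * e x) * complex_cond_exp M F (\<lambda>x. u x * w x) x"
    by (intro complex_cond_exp_mult uw) auto
  ultimately show ?thesis
    unfolding wct_def[of M F w u "\<lambda>x. b x * g x + d x * wct M F w u g x"] eq
    by eventually_elim (simp add: wct_def e_def algebra_simps)
qed

text \<open>Surjectivity of \<open>I - T\<close>. With \<open>s = |1 - v|\<^sup>1\<^sup>/\<^sup>2\<close> and \<open>a = s / (1 - v)\<close>, the fact \<open>half\<close> is the half
  step: \<open>a T g\<close> is in the space. Its second application produces \<open>a\<^sup>2 v T g\<close>, and \<open>|a|\<^sup>2 = 1 / |1 - v|\<close>.\<close>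

lemma orlicz_range_eq_orlicz:
  fixes w u :: "'a \<Rightarrow> complex"
  defines "T \<equiv> wct M F w u" and "v \<equiv> complex_cond_exp M F (\<lambda>x. u x * w x)"
  assumes \<Phi>: "young_function \<Phi>"
    and [measurable]: "u \<in> borel_measurable M" and w[measurable]: "w \<in> borel_measurable M"
    and uw: "cond_exp_defined M F (\<lambda>x. u x * w x)"
    and uf: "\<And>f. f \<in> orlicz M \<Phi> \<Longrightarrow> cond_exp_defined M F (\<lambda>x. u x * f x)"
    and T: "\<And>f. f \<in> orlicz M \<Phi> \<Longrightarrow> T f \<in> orlicz M \<Phi>"
    and v_bound: "AE x in M. cmod (v x) \<le> 1" and v_ne: "AE x in M. v x \<noteq> 1"
    and closed: "orlicz_closed M \<Phi> (orlicz_range M \<Phi> (\<lambda>f x. f x - T f x))"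
  shows "orlicz_range M \<Phi> (\<lambda>f x. f x - T f x) = orlicz M \<Phi>"
proof
  let ?L = "orlicz M \<Phi>" and ?R = "orlicz_range M \<Phi> (\<lambda>f x. f x - T f x)"
  show "?R \<subseteq> ?L" using closed by (simp add: orlicz_closed_def)
  have v[measurable]: "v \<in> borel_measurable F" unfolding v_def by measurable
  have [measurable]: "v \<in> borel_measurable M" by (rule measurable_from_subalg[OF subalg v])
  have meas: "f \<in> borel_measurable M" if "f \<in> ?L" for f using that by (simp add: orlicz_def)
  have comb: "AE x in M. T (\<lambda>x. b x * g x + d x * T g x) x = (b x + d x * v x) * T g x"
    if "g \<in> ?L" "b \<in> borel_measurable F" "d \<in> borel_measurable F" for g b d
    unfolding T_def v_def using that uf uw by (intro wct_combination) auto
  define s where "s = (\<lambda>x. complex_of_real (sqrt (cmod (1 - v x))))"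
  define a where "a = (\<lambda>x. s x / (1 - v x))"
  have s[measurable]: "s \<in> borel_measurable F" unfolding s_def by measurable
  have a[measurable]: "a \<in> borel_measurable F" unfolding a_def by measurable
  have [measurable]: "s \<in> borel_measurable M" "a \<in> borel_measurable M"
    using s a by (auto intro: measurable_from_subalg[OF subalg])
  have s_bound: "AE x in M. cmod (s x) \<le> 2"
    using v_bound
  proof eventually_elim
    case (elim x)
    have "cmod (1 - v x) \<le> 2" using norm_triangle_ineq4[of 1 "v x"] elim by simp
    then have "sqrt (cmod (1 - v x)) \<le> sqrt (2\<^sup>2)" by (intro real_sqrt_le_mono) auto
    then show ?case by (simp add: s_def)
  qed
  have half: "(\<lambda>x. a x * T g x) \<in> ?L" if g: "g \<in> ?L" for g
  proof -
    note [measurable] = meas[OF g] meas[OF T[OF g]]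
    define sg where "sg = (\<lambda>x. s x * g x)"
    have [measurable]: "sg \<in> borel_measurable M" unfolding sg_def by measurable
    have sg: "sg \<in> ?L"
    proof (rule orlicz_dominated[OF \<Phi> g, where C = 2])
      show "AE x in M. cmod (sg x) \<le> 2 * cmod (g x)"
        using s_bound by eventually_elim (auto simp: sg_def norm_mult intro!: mult_right_mono)
    qed measurable
    obtain K where K: "0 < K" and norm_le: "\<And>h e. 0 < e \<Longrightarrow>
        (AE x in M. cmod (h x) \<le> e * cmod (g x)) \<Longrightarrow> orlicz_norm M \<Phi> h \<le> e * K"
      using orlicz_norm_dominated[OF \<Phi> g] by metis
    have "\<exists>r\<in>?R. orlicz_norm M \<Phi> (\<lambda>x. sg x - r x) < e" if e: "0 < e" for e
    proof -
      (* The cutoff level for |1 - v| is the square of \<eta> because s is a square root. *)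
      define \<eta> where "\<eta> = e / (2 * K)"
      have \<eta>: "0 < \<eta>" "\<eta> * K < e" using e K by (auto simp: \<eta>_def)
      define b where "b = (\<lambda>x. if \<eta>\<^sup>2 \<le> cmod (1 - v x) then s x else 0)"
      define d where "d = (\<lambda>x. b x / (1 - v x))"
      have b[measurable]: "b \<in> borel_measurable F" unfolding b_def by measurable
      have d[measurable]: "d \<in> borel_measurable F" unfolding d_def by measurable
      have [measurable]: "b \<in> borel_measurable M" "d \<in> borel_measurable M"
        using b d by (auto intro: measurable_from_subalg[OF subalg])
      have "(\<lambda>x. b x * g x) \<in> ?L"
      proof (rule orlicz_dominated[OF \<Phi> g, where C = 2])
        show "AE x in M. cmod (b x * g x) \<le> 2 * cmod (g x)"
          using s_bound by eventually_elim (auto simp: b_def norm_mult intro!: mult_right_mono)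
      qed measurable
      moreover have "(\<lambda>x. d x * T g x) \<in> ?L"
      proof (rule orlicz_dominated[OF \<Phi> T[OF g], where C = "2 / \<eta>\<^sup>2"])
        show "AE x in M. cmod (d x * T g x) \<le> 2 / \<eta>\<^sup>2 * cmod (T g x)"
          using s_bound
        proof eventually_elim
          case (elim x)
          have "cmod (d x) \<le> 2 / \<eta>\<^sup>2"
            using elim \<eta> by (auto simp: d_def b_def norm_divide intro!: frac_le)
          then show ?case unfolding norm_mult by (intro mult_right_mono) auto
        qed
      qed measurable
      ultimately have h: "(\<lambda>x. b x * g x + d x * T g x) \<in> ?L" (is "?h \<in> _")
        by (rule orlicz_add[OF \<Phi>])
      define r where "r = (\<lambda>x. ?h x - T ?h x)"
      have "r \<in> ?R"
        unfolding orlicz_range_def using h meas[OF h] meas[OF T[OF h]] by (auto simp: r_def)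
      moreover have "AE x in M. cmod (sg x - r x) \<le> \<eta> * cmod (g x)"
        using comb[OF g b d] v_ne
      proof eventually_elim
        case (elim x)
        have "b x = d x * (1 - v x)" using elim(2) by (simp add: d_def)
        then have "r x = b x * g x"
          unfolding r_def elim(1) by (simp add: algebra_simps)
        then have "sg x - r x = (s x - b x) * g x" by (simp add: sg_def algebra_simps)
        moreover have "cmod (s x - b x) \<le> \<eta>"
          using \<eta> by (auto simp: b_def s_def intro!: real_le_lsqrt)
        ultimately show ?case by (simp add: norm_mult mult_right_mono)
      qed
      then have "orlicz_norm M \<Phi> (\<lambda>x. sg x - r x) \<le> \<eta> * K" using \<eta> by (intro norm_le) auto
      ultimately show ?thesis using \<eta> by force
    qed
    then have "sg \<in> ?R" using closed sg by (auto simp: orlicz_closed_def)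
    then obtain f where f: "f \<in> ?L" "AE x in M. sg x = f x - T f x"
      by (auto simp: orlicz_range_def)
    note [measurable] = meas[OF f(1)] meas[OF T[OF f(1)]]
    \<comment> \<open>Comparing \<open>T\<close> of both sides of \<open>s g = f - T f\<close> identifies \<open>T f\<close> as \<open>a T g\<close>.\<close>
    have "AE x in M. T sg x = s x * T g x"
      using comb[OF g s, of "\<lambda>x. 0"] by (simp add: sg_def)
    moreover have "AE x in M. T (\<lambda>x. f x - T f x) x = (1 - v x) * T f x"
      using comb[OF f(1), of "\<lambda>x. 1" "\<lambda>x. -1"] by simp
    moreover have "AE x in M. T sg x = T (\<lambda>x. f x - T f x) x"
      using f(2) unfolding T_def by (intro wct_cong) (simp_all flip: T_def)
    ultimately have "AE x in M. a x * T g x = T f x"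
      using v_ne by eventually_elim (simp add: a_def field_simps)
    then show ?thesis
      by (intro orlicz_dominated[OF \<Phi> T[OF f(1)], where C = 1]) auto
  qed
  show "?L \<subseteq> ?R"
  proof
    fix g assume g: "g \<in> ?L"
    note [measurable] = meas[OF g] meas[OF T[OF g]]
    have "AE x in M. T (\<lambda>x. a x * T g x) x = a x * v x * T g x"
      using comb[OF g _ a, of "\<lambda>x. 0"] by simp
    then have "AE x in M. cmod (v x / (1 - v x) * T g x) \<le> 1 * cmod (a x * T (\<lambda>x. a x * T g x) x)"
      using v_ne
    proof eventually_elim
      case (elim x)
      have "cmod (a x) * cmod (a x) = 1 / cmod (1 - v x)"
        using elim by (simp add: a_def s_def norm_divide)
      then show ?case
        unfolding elim(1) by (simp add: norm_mult norm_divide mult.assoc[symmetric])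
    qed
    then have "(\<lambda>x. v x / (1 - v x) * T g x) \<in> ?L"
      by (rule orlicz_dominated[OF \<Phi> half[OF half[OF g]], rotated]) measurable
    from orlicz_add[OF \<Phi> T[OF g] this] have sum: "(\<lambda>x. T g x + v x / (1 - v x) * T g x) \<in> ?L" .
    have "(\<lambda>x. inverse (1 - v x) * T g x) \<in> ?L"
    proof (rule orlicz_dominated[OF \<Phi> sum, where C = 1])
      show "AE x in M. cmod (inverse (1 - v x) * T g x)
          \<le> 1 * cmod (T g x + v x / (1 - v x) * T g x)"
        using v_ne
      proof eventually_elim
        case (elim x)
        then have "inverse (1 - v x) * T g x = T g x + v x / (1 - v x) * T g x"
          by (simp add: field_simps)
        then show ?case by simp
      qed
    qed measurable
    from orlicz_add[OF \<Phi> g this]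
    have h: "(\<lambda>x. 1 * g x + inverse (1 - v x) * T g x) \<in> ?L" (is "?h \<in> _") by simp
    have "AE x in M. T ?h x = (1 + inverse (1 - v x) * v x) * T g x"
      by (intro comb[OF g]) measurable
    then have "AE x in M. g x = ?h x - T ?h x"
      using v_ne by eventually_elim (simp add: field_simps)
    then show "g \<in> ?R"
      unfolding orlicz_range_def using meas[OF g] by (intro CollectI conjI bexI[OF _ h])
  qed
qed

lemma orlicz_null_space_I_minus_wct:
  fixes w u :: "'a \<Rightarrow> complex"
  defines "T \<equiv> wct M F w u" and "v \<equiv> complex_cond_exp M F (\<lambda>x. u x * w x)"
  assumes u: "u \<in> borel_measurable M" and w: "w \<in> borel_measurable M"
    and uw: "cond_exp_defined M F (\<lambda>x. u x * w x)"
    and uf: "\<And>f. f \<in> orlicz M \<Phi> \<Longrightarrow> cond_exp_defined M F (\<lambda>x. u x * f x)"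
    and v_ne: "AE x in M. v x \<noteq> 1"
    and f: "f \<in> orlicz_null_space M \<Phi> (\<lambda>f x. f x - T f x)"
  shows "AE x in M. f x = 0"
proof -
  have fL: "f \<in> orlicz M \<Phi>" and fix_f: "AE x in M. f x = T f x"
    using f by (auto simp: orlicz_null_space_def)
  have "AE x in M. T f x = T (T f) x"
    using fix_f fL u w unfolding T_def by (intro wct_cong wct_measurable) (auto simp: orlicz_def)
  moreover have "AE x in M. T (T f) x = v x * T f x"
    using wct_combination[OF _ _ uw uf[OF fL], of "\<lambda>x. 0" "\<lambda>x. 1"] by (simp add: T_def v_def)
  ultimately show ?thesis
    using fix_f v_ne by eventually_elim simp
qed

end

section \<open>The decomposition\<close>

theorem proposition2p15:
  fixes M F :: "'a measure" and \<Phi> :: "real \<Rightarrow> ennreal" and u w :: "'a \<Rightarrow> complex"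
  defines "\<Psi> \<equiv> complementary \<Phi>"
    and "I_minus_T \<equiv> (\<lambda>f x. f x - wct M F w u f x)"
  assumes "complete_measure M" and "sigma_finite_measure M"
    and "sigma_finite_subalgebra M F"
    and "young_function \<Phi>"
    and "u \<in> borel_measurable M" and "w \<in> borel_measurable M"
    and "cond_exp_defined M F (\<lambda>x. u x * w x)"
    and "\<And>f. f \<in> orlicz M \<Phi> \<Longrightarrow> cond_exp_defined M F (\<lambda>x. u x * f x)"
    and "orlicz_bounded M \<Phi> (wct M F w u)"
    and "AE x in M.
           gen_inverse \<Phi> (nn_cond_exp M F (\<lambda>x. \<Phi> (cmod (w x))) x) \<noteq> 0 \<and>
           gen_inverse \<Psi> (nn_cond_exp M F (\<lambda>x. \<Psi> (cmod (u x))) x) \<noteq> 0 \<longrightarrow>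
           cmod (complex_cond_exp M F (\<lambda>x. w x * u x) x) < 1"
    and "orlicz_closed M \<Phi> (orlicz_range M \<Phi> I_minus_T)"
  shows "ae_direct_sum M (orlicz M \<Phi>)
           (orlicz_range M \<Phi> I_minus_T) (orlicz_null_space M \<Phi> I_minus_T)"
proof -
  interpret sigma_finite_subalgebra M F by fact
  note \<Phi> = \<open>young_function \<Phi>\<close>
  let ?L = "orlicz M \<Phi>" and ?R = "orlicz_range M \<Phi> I_minus_T" and ?N = "orlicz_null_space M \<Phi> I_minus_T"
  define v where "v = complex_cond_exp M F (\<lambda>x. u x * w x)"
  have "AE x in M. gen_inverse \<Phi> (nn_cond_exp M F (\<lambda>x. \<Phi> (cmod (w x))) x) = 0 \<longrightarrow> v x = 0"
    unfolding v_def
    by (intro complex_cond_exp_zero_where_gen_inverse_zero star_shaped_young assms) simp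
  moreover have "AE x in M. gen_inverse \<Psi> (nn_cond_exp M F (\<lambda>x. \<Psi> (cmod (u x))) x) = 0 \<longrightarrow> v x = 0"
    unfolding v_def \<Psi>_def
    by (intro complex_cond_exp_zero_where_gen_inverse_zero star_shaped_complementary assms) simp
  moreover have "(\<lambda>x. w x * u x) = (\<lambda>x. u x * w x)" by (simp add: mult.commute)
  note assms(12)[unfolded this, folded v_def]
  ultimately have v: "AE x in M. cmod (v x) < 1"
    by eventually_elim auto
  have v_ne: "AE x in M. v x \<noteq> 1"
    using v by eventually_elim auto
  have R: "?R = ?L"
    unfolding I_minus_T_def
  proof (rule orlicz_range_eq_orlicz)
    show "AE x in M. cmod (complex_cond_exp M F (\<lambda>x. u x * w x) x) \<le> 1"
      using v unfolding v_def by eventually_elim simp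
  qed (use assms v_ne in \<open>auto simp: orlicz_bounded_def v_def\<close>)
  have N_zero: "AE x in M. f x = 0" if "f \<in> ?N" for f
    by (rule orlicz_null_space_I_minus_wct[of u w \<Phi>])
       (use assms v_ne that in \<open>auto simp: v_def\<close>)
  \<comment> \<open>It remains to translate \<open>R = L\<close>, \<open>N = {0}\<close> into statements about representatives.\<close>
  have zero: "(\<lambda>x. 0) \<in> ?L"
    using \<Phi> by (auto simp: orlicz_def young_function_def intro!: exI[of _ 1])
  have zero_L: "h \<in> ?L" if "h \<in> borel_measurable M" "AE x in M. h x = 0" for h
    using that by (intro orlicz_dominated[OF \<Phi> zero, where C = 1]) auto
  (* A null function h equals 0 h + 0 T h almost everywhere, which T maps to (0 + 0 v) T h = 0. *)
  have zero_N: "h \<in> ?N" if h: "h \<in> borel_measurable M" "AE x in M. h x = 0" for h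
  proof -
    have "AE x in M. wct M F w u h x = wct M F w u (\<lambda>x. 0 * h x + 0 * wct M F w u h x) x"
      using h assms by (intro wct_cong) auto
    moreover have "AE x in M. wct M F w u (\<lambda>x. 0 * h x + 0 * wct M F w u h x) x
        = (0 + 0 * v x) * wct M F w u h x"
      unfolding v_def using assms zero_L[OF h] by (intro wct_combination) auto
    ultimately have "AE x in M. I_minus_T h x = 0"
      using h(2) unfolding I_minus_T_def by eventually_elim simp
    with zero_L[OF h] show ?thesis by (simp add: orlicz_null_space_def)
  qed
  show ?thesis
    unfolding ae_direct_sum_def R
  proof (intro conjI set_eqI iffI)
    fix h assume h: "h \<in> ?L"
    have "(\<lambda>x. 0) \<in> ?N" by (rule zero_N) auto
    then show "h \<in> {h \<in> borel_measurable M. \<exists>f\<in>?L. \<exists>g\<in>?N. AE x in M. h x = f x + g x}"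
      using h by (force simp: orlicz_def)
  next
    fix h assume "h \<in> {h \<in> borel_measurable M. \<exists>f\<in>?L. \<exists>g\<in>?N. AE x in M. h x = f x + g x}"
    then obtain f g where h: "h \<in> borel_measurable M" "f \<in> ?L" "g \<in> ?N" "AE x in M. h x = f x + g x"
      by blast
    have "AE x in M. cmod (h x) \<le> 1 * cmod (f x)"
      using h(4) N_zero[OF h(3)] by eventually_elim simp
    then show "h \<in> ?L" by (rule orlicz_dominated[OF \<Phi> h(2,1)])
  next
    fix h assume "h \<in> ?L \<inter> ?N"
    then show "h \<in> {h \<in> borel_measurable M. AE x in M. h x = 0}"
      using N_zero by (auto simp: orlicz_def)
  next
    fix h :: "'a \<Rightarrow> complex" assume "h \<in> {h \<in> borel_measurable M. AE x in M. h x = 0}"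
    then have h: "h \<in> borel_measurable M" "AE x in M. h x = 0" by blast+
    from zero_L[OF h] zero_N[OF h] show "h \<in> ?L \<inter> ?N" by (rule IntI)
  qed
qed

end
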